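(* For every integer $n \geq 7$ with $n \neq 13$ there is a word $w(x_1,x_2) \in F_2$ such that $\mathrm{Alt}(n)_w$ consists exactly of the identity and all $3$-cycles. When $n = 13$ there is a word $w(x_1,x_2,x_3) \in F_3$ with the same property, i.e. such that $\mathrm{Alt}(13)_w$ consists exactly of the identity and all $3$-cycles.
   Context: $F_d$ denotes the free group on $x_1,\ldots,x_d$, and a word is an element of $F_d$. For a group $G$ and a word $w \in F_d$, the set of values of $w$ is $G_w := \{ w(g_1,\ldots,g_d)^{\pm 1} : g_1,\ldots,g_d \in G\}$. $\mathrm{Alt}(n)$ is the alternating group on $n$ points. The word $w$ is allowed to depend on $n$. *)

theory Defs
  imports "HOL-Algebra.Sym_Groups"
begin

(* The free group F_d on x_1, ..., x_d is realised on reduced words.  The letter (i, True)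
   stands for x_i and (i, False) for its inverse. *)

type_synonym letter = "nat \<times> bool"

definition cancelling :: "letter \<Rightarrow> letter \<Rightarrow> bool"
  where "cancelling a b \<longleftrightarrow> fst a = fst b \<and> snd a \<noteq> snd b"

definition reduced :: "letter list \<Rightarrow> bool"
  where "reduced w \<longleftrightarrow> successively (\<lambda>a b. \<not> cancelling a b) w"

fun reduced_cons :: "letter \<Rightarrow> letter list \<Rightarrow> letter list"
  where
    "reduced_cons a [] = [a]"
  | "reduced_cons a (b # w) = (if cancelling a b then w else a # b # w)"

definition free_group :: "nat \<Rightarrow> letter list monoid"
  where "free_group d =
    \<lparr> carrier = { w. reduced w \<and> set w \<subseteq> {1..d} \<times> UNIV },
      mult = foldr reduced_cons,
      one = [] \<rparr>"

definition letter_value :: "('a, 'b) monoid_scheme \<Rightarrow> (nat \<Rightarrow> 'a) \<Rightarrow> letter \<Rightarrow> 'a"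
  where "letter_value G g a = (if snd a then g (fst a) else inv\<^bsub>G\<^esub> g (fst a))"

definition word_value :: "('a, 'b) monoid_scheme \<Rightarrow> (nat \<Rightarrow> 'a) \<Rightarrow> letter list \<Rightarrow> 'a"
  where "word_value G g w = foldr (\<lambda>a y. letter_value G g a \<otimes>\<^bsub>G\<^esub> y) w \<one>\<^bsub>G\<^esub>"

definition word_values :: "('a, 'b) monoid_scheme \<Rightarrow> nat \<Rightarrow> letter list \<Rightarrow> 'a set"
  where "word_values G d w =
    (\<Union>g \<in> {1..d} \<rightarrow> carrier G. { word_value G g w, inv\<^bsub>G\<^esub> (word_value G g w) })"

lemma reduced_Nil [simp]: "reduced []"
  by (simp add: reduced_def)

lemma reduced_ConsD: "reduced (a # w) \<Longrightarrow> reduced w"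
  by (cases w) (auto simp: reduced_def)

lemma reduced_reduced_cons: "reduced w \<Longrightarrow> reduced (reduced_cons a w)"
  by (cases w) (auto simp: reduced_def successively_Cons)

lemma reduced_mult: "reduced v \<Longrightarrow> reduced (foldr reduced_cons u v)"
  by (induction u) (auto intro: reduced_reduced_cons)

lemma set_reduced_cons: "set (reduced_cons a w) \<subseteq> insert a (set w)"
  by (cases w) auto

lemma set_mult: "set (foldr reduced_cons u v) \<subseteq> set u \<union> set v"
proof (induction u)
  case (Cons a u)
  then show ?case using set_reduced_cons[of a "foldr reduced_cons u v"] by auto
qed simp

lemma reduced_cons_cancel:
  assumes "cancelling a b" "reduced w"
  shows "reduced_cons a (reduced_cons b w) = w"
proof (cases w)
  case (Cons c w')
  show ?thesis
  proof (cases "cancelling b c")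
    case True
    then have "a = c" using assms(1) by (auto simp: cancelling_def prod_eq_iff)
    then show ?thesis using True Cons assms(2)
      by (cases w') (auto simp: reduced_def)
  next
    case False
    then show ?thesis using Cons assms(1) by simp
  qed
qed (use assms in simp)

lemma mult_reduced_cons:
  assumes "reduced v"
  shows "foldr reduced_cons (reduced_cons a u) v = reduced_cons a (foldr reduced_cons u v)"
  using assms by (cases u) (auto simp: reduced_cons_cancel reduced_mult)

lemma mult_assoc_reduced:
  assumes "reduced w"
  shows "foldr reduced_cons (foldr reduced_cons u v) w =
         foldr reduced_cons u (foldr reduced_cons v w)"
  using assms by (induction u) (auto simp: mult_reduced_cons)

lemma mult_Nil_reduced: "reduced u \<Longrightarrow> foldr reduced_cons u [] = u"
proof (induction u)
  case (Cons a u)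
  then have "foldr reduced_cons u [] = u" by (auto dest: reduced_ConsD)
  then show ?case using Cons.prems by (cases u) (auto simp: reduced_def)
qed simp

lemma ex_left_inverse:
  assumes "reduced u" "set u \<subseteq> A \<times> UNIV"
  shows "\<exists>v. reduced v \<and> set v \<subseteq> A \<times> UNIV \<and> foldr reduced_cons v u = []"
  using assms
proof (induction u)
  case Nil
  show ?case by (intro exI[of _ "[]"]) simp
next
  case (Cons a u)
  then obtain v where v: "reduced v" "set v \<subseteq> A \<times> UNIV" "foldr reduced_cons v u = []"
    by (auto dest: reduced_ConsD)
  define b where "b = (fst a, \<not> snd a)"
  let ?v = "foldr reduced_cons v [b]"
  have "cancelling b a" by (simp add: b_def cancelling_def)
  then have "foldr reduced_cons ?v (a # u) = []"
    using mult_assoc_reduced[OF Cons.prems(1), of v "[b]"] v(3) by simp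
  moreover have "reduced ?v" by (rule reduced_mult) (simp add: reduced_def)
  moreover have "set ?v \<subseteq> A \<times> UNIV"
    using set_mult[of v "[b]"] v(2) Cons.prems(2) by (auto simp: b_def)
  ultimately show ?case by blast
qed

lemma free_group_is_group: "group (free_group d)"
proof (rule groupI)
  fix u v assume "u \<in> carrier (free_group d)" "v \<in> carrier (free_group d)"
  then show "u \<otimes>\<^bsub>free_group d\<^esub> v \<in> carrier (free_group d)"
    using set_mult[of u v] by (auto simp: free_group_def reduced_mult)
next
  fix u assume "u \<in> carrier (free_group d)"
  then show "\<exists>v \<in> carrier (free_group d). v \<otimes>\<^bsub>free_group d\<^esub> u = \<one>\<^bsub>free_group d\<^esub>"
    using ex_left_inverse[of u "{1..d}"] by (auto simp: free_group_def)
qed (auto simp: free_group_def mult_assoc_reduced)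

context group
begin

lemma letter_value_closed:
  "g \<in> A \<rightarrow> carrier G \<Longrightarrow> a \<in> A \<times> UNIV \<Longrightarrow> letter_value G g a \<in> carrier G"
  by (auto simp: letter_value_def)

lemma word_value_closed:
  "g \<in> A \<rightarrow> carrier G \<Longrightarrow> set w \<subseteq> A \<times> UNIV \<Longrightarrow> word_value G g w \<in> carrier G"
  by (induction w) (auto simp: word_value_def intro!: letter_value_closed)

lemma word_value_reduced_cons:
  assumes g: "g \<in> A \<rightarrow> carrier G" and "a \<in> A \<times> UNIV" "set w \<subseteq> A \<times> UNIV"
  shows "word_value G g (reduced_cons a w) = letter_value G g a \<otimes> word_value G g w"
proof (cases w)
  case (Cons b w')
  have *: "letter_value G g a \<otimes> letter_value G g b = \<one>" if "cancelling a b"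
    using that g assms(2) by (auto simp: cancelling_def letter_value_def Pi_iff)
  have "letter_value G g a \<in> carrier G" "letter_value G g b \<in> carrier G"
       "word_value G g w' \<in> carrier G"
    using assms Cons by (auto intro!: letter_value_closed[OF g] word_value_closed[OF g])
  then show ?thesis using Cons *
    by (auto simp: word_value_def m_assoc[symmetric])
qed (simp add: word_value_def)

lemma word_value_hom:
  assumes g: "g \<in> {1..d} \<rightarrow> carrier G"
  shows "word_value G g \<in> hom (free_group d) G"
proof (rule homI)
  fix u assume "u \<in> carrier (free_group d)"
  then show "word_value G g u \<in> carrier G"
    using word_value_closed[OF g] by (auto simp: free_group_def)
next
  fix u v assume "u \<in> carrier (free_group d)" "v \<in> carrier (free_group d)"
  then have "set u \<subseteq> {1..d} \<times> UNIV" "set v \<subseteq> {1..d} \<times> UNIV"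
    by (auto simp: free_group_def)
  then have "word_value G g (foldr reduced_cons u v) = word_value G g u \<otimes> word_value G g v"
  proof (induction u)
    case Nil
    then show ?case using word_value_closed[OF g] by (simp add: word_value_def)
  next
    case (Cons a u)
    then have "word_value G g (foldr reduced_cons (a # u) v) =
        letter_value G g a \<otimes> (word_value G g u \<otimes> word_value G g v)"
      using word_value_reduced_cons[OF g, of a "foldr reduced_cons u v"] set_mult[of u v]
      by auto
    also have "\<dots> = word_value G g (a # u) \<otimes> word_value G g v"
      using Cons.prems letter_value_closed[OF g, of a] word_value_closed[OF g, of u]
        word_value_closed[OF g, of v]
      by (simp add: word_value_def m_assoc)
    finally show ?case .
  qed
  then show "word_value G g (u \<otimes>\<^bsub>free_group d\<^esub> v) = word_value G g u \<otimes> word_value G g v"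
    by (simp add: free_group_def)
qed

lemma word_value_generator:
  "g i \<in> carrier G \<Longrightarrow> word_value G g [(i, True)] = g i"
  by (simp add: word_value_def letter_value_def)

end

end

theory Submission
  imports Defs "HOL-Algebra.SimpleGroups"
begin

text \<open>
  The argument works for every finite nonabelian simple group \<^term>\<open>G\<close> and every generating tuple
  \<^term>\<open>g\<close> of \<^term>\<open>G\<close>. A \<^term>\<open>d\<close>-tuple of elements is the same as a homomorphism from the free
  group of rank \<^term>\<open>d\<close>, whose value at a word is the value of the word at the tuple. If the
  kernel belonging to a tuple \<^term>\<open>h\<close> is contained in the kernel belonging to \<^term>\<open>g\<close>, then
  by counting \<^term>\<open>h\<close> is the image of \<^term>\<open>g\<close> under an automorphism
  (\<open>ex_automorphism_of_kernel_le\<close>). Each of the remaining kernels is therefore mapped by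
  evaluation at \<^term>\<open>g\<close> onto a nontrivial normal subgroup, that is, onto \<^term>\<open>G\<close>, and taking
  commutators shows that the intersection of these finitely many kernels is still mapped onto
  \<^term>\<open>G\<close> (\<open>ex_normal_in_kernels_onto\<close>). So there is a word that vanishes off the automorphism
  orbit of \<^term>\<open>g\<close> and takes any prescribed value \<^term>\<open>c\<close> at \<^term>\<open>g\<close>. Its set of values consists
  of the identity, the images of \<^term>\<open>c\<close> under automorphisms, and the inverses of these
  (\<open>ex_word_values_eq_automorphism_orbit\<close>).

  For the alternating group three facts remain. It is simple, because commutators with suitable
  3-cycles shrink a nontrivial element to a 3-cycle (\<open>alt_group_simple\<close>). It is generated by
  \<open>(1 2 3)\<close> and a long cycle (\<open>alt_group_two_generated\<close>). Finally, the 3-cycles form one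
  orbit of the automorphism group: they are conjugate to each other, and an automorphism maps
  3-cycles to 3-cycles, because the 3-cycles are the elements \<^term>\<open>x\<close> of order 3 for which the
  product of \<^term>\<open>x\<close> with each of its conjugates has order 1, 2, 3 or 5
  (\<open>three_cycle_iff\<close>). The construction is uniform in \<^term>\<open>n\<close>; with three letters the tuple
  repeats a generator.
\<close>

section \<open>Words with prescribed values in simple groups\<close>

text \<open>Since \<^term>\<open>\<psi>\<close> identifies no more than the surjection \<^term>\<open>\<phi>\<close> does,
  \<^term>\<open>\<psi> u\<close> determines \<^term>\<open>\<phi> u\<close>. This gives a map from the image of \<^term>\<open>\<psi>\<close> onto
  \<^term>\<open>G\<close>, and counting forces that image to be all of \<^term>\<open>G\<close> and the map to be a bijection.
  Its inverse is the automorphism.\<close>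

lemma (in group) ex_automorphism_of_kernel_le:
  assumes F: "group F" and \<phi>: "\<phi> \<in> hom F G" and \<psi>: "\<psi> \<in> hom F G"
    and surj: "\<phi> ` carrier F = carrier G" and fin: "finite (carrier G)"
    and le: "kernel F G \<psi> \<subseteq> kernel F G \<phi>"
  shows "\<exists>\<alpha> \<in> iso G G. \<forall>u \<in> carrier F. \<psi> u = \<alpha> (\<phi> u)"
proof -
  interpret \<phi>: group_hom F G \<phi> using F \<phi> is_group by (simp add: group_hom_def group_hom_axioms_def)
  interpret \<psi>: group_hom F G \<psi> using F \<psi> is_group by (simp add: group_hom_def group_hom_axioms_def)
  have eq: "\<phi> u = \<phi> v" if u: "u \<in> carrier F" and v: "v \<in> carrier F" and "\<psi> u = \<psi> v" for u v
  proof -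
    have "u \<otimes>\<^bsub>F\<^esub> inv\<^bsub>F\<^esub> v \<in> kernel F G \<psi>" using that by (simp add: kernel_def)
    then have "\<phi> (u \<otimes>\<^bsub>F\<^esub> inv\<^bsub>F\<^esub> v) = \<one>" using le by (auto simp: kernel_def)
    then have "\<phi> u \<otimes> inv (\<phi> v) = \<one>" using u v by simp
    then show ?thesis using u v by (metis \<phi>.hom_closed inv_equality inv_closed inv_inv)
  qed
  define \<theta> where "\<theta> y = \<phi> (SOME u. u \<in> carrier F \<and> \<psi> u = y)" for y
  have \<theta>: "\<theta> (\<psi> u) = \<phi> u" if "u \<in> carrier F" for u
    unfolding \<theta>_def using someI[of "\<lambda>v. v \<in> carrier F \<and> \<psi> v = \<psi> u" u] that eq by blast
  have img: "\<theta> ` (\<psi> ` carrier F) = carrier G"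
    using \<theta> surj by (metis (mono_tags, lifting) image_cong image_image)
  have sub: "\<psi> ` carrier F \<subseteq> carrier G" by auto
  have "card (carrier G) \<le> card (\<psi> ` carrier F)"
    using img card_image_le[of "\<psi> ` carrier F" \<theta>] finite_subset[OF sub fin] by simp
  then have onto: "\<psi> ` carrier F = carrier G" using card_seteq[OF fin sub] by simp
  have "inj_on \<theta> (carrier G)" using img onto fin by (simp add: eq_card_imp_inj_on)
  then have bij: "bij_betw \<theta> (carrier G) (carrier G)" using img onto by (simp add: bij_betw_def)
  have "\<theta> \<in> hom G G"
  proof (rule homI)
    fix x y assume "x \<in> carrier G" "y \<in> carrier G"
    then have "x \<in> \<psi> ` carrier F" "y \<in> \<psi> ` carrier F" by (simp_all add: onto)
    then obtain u v where "u \<in> carrier F" "v \<in> carrier F" "x = \<psi> u" "y = \<psi> v" by (elim imageE)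
    then show "\<theta> (x \<otimes> y) = \<theta> x \<otimes> \<theta> y"
      using \<theta>[of "u \<otimes>\<^bsub>F\<^esub> v"] \<theta>[of u] \<theta>[of v] by simp
  qed (rule bij_betwE[OF bij, rule_format])
  then have "\<theta> \<in> iso G G" using bij by (simp add: iso_def)
  then have "inv_into (carrier G) \<theta> \<in> iso G G" by (rule iso_set_sym)
  moreover have "\<psi> u = inv_into (carrier G) \<theta> (\<phi> u)" if "u \<in> carrier F" for u
    using \<theta>[OF that] bij that by (metis \<psi>.hom_closed bij_betw_inv_into_left)
  ultimately show ?thesis by blast
qed

text \<open>The step from \<^term>\<open>S\<close> to one more kernel: two normal subgroups that both map onto a
  nonabelian simple group contain elements whose images do not commute. The commutator of these
  elements lies in the intersection and has a nontrivial image, and simplicity makes the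
  intersection map onto the group again.\<close>

lemma (in simple_group) ex_normal_in_kernels_onto:
  assumes noncomm: "x \<in> carrier G" "y \<in> carrier G" "x \<otimes> y \<noteq> y \<otimes> x"
    and F: "group F" and \<phi>: "\<phi> \<in> hom F G" and surj: "\<phi> ` carrier F = carrier G"
    and "finite S" and "\<And>\<psi>. \<psi> \<in> S \<Longrightarrow> \<psi> \<in> hom F G \<and> \<not> kernel F G \<psi> \<subseteq> kernel F G \<phi>"
  shows "\<exists>N. N \<lhd> F \<and> (\<forall>\<psi> \<in> S. N \<subseteq> kernel F G \<psi>) \<and> \<phi> ` N = carrier G"
  using assms(7,8)
proof (induction S)
  case empty
  interpret F: group F by (rule F)
  have "carrier F \<lhd> F" by (rule F.normal_invI[OF F.subgroup_self]) simp
  then show ?case using surj by blast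
next
  case (insert \<psi> S)
  then obtain N where N: "N \<lhd> F" "\<forall>\<psi> \<in> S. N \<subseteq> kernel F G \<psi>" "\<phi> ` N = carrier G" by auto
  interpret \<phi>: group_hom F G \<phi> using F \<phi> is_group by (simp add: group_hom_def group_hom_axioms_def)
  interpret \<psi>: group_hom F G \<psi>
    using F insert.prems is_group by (simp add: group_hom_def group_hom_axioms_def)
  have dich: "\<phi> ` M = carrier G \<or> \<phi> ` M = {\<one>}" if "M \<lhd> F" for M
    using no_real_normal_subgroup normal.surj_hom_normal_subgroup[OF that \<phi>.group_hom_axioms surj] .
  let ?K = "kernel F G \<psi>"
  have K: "?K \<lhd> F" by (rule \<psi>.normal_kernel)
  have "\<phi> ` ?K \<noteq> {\<one>}" using insert.prems by (auto simp: kernel_def)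
  then have onto: "\<phi> ` ?K = carrier G" using dich[OF K] by blast
  have NK: "N \<inter> ?K \<lhd> F" by (rule \<phi>.G.normal_subgroup_intersect[OF N(1) K])
  obtain u v where u: "u \<in> N" "\<phi> u = x" and v: "v \<in> ?K" "\<phi> v = y"
    using noncomm N(3) onto by (metis imageE)
  interpret N: normal N F by (rule N(1))
  interpret K: normal ?K F by (rule K)
  let ?c = "u \<otimes>\<^bsub>F\<^esub> v \<otimes>\<^bsub>F\<^esub> inv\<^bsub>F\<^esub> u \<otimes>\<^bsub>F\<^esub> inv\<^bsub>F\<^esub> v"
  have uF: "u \<in> carrier F" and vF: "v \<in> carrier F" using u v by auto
  have "?c = u \<otimes>\<^bsub>F\<^esub> (v \<otimes>\<^bsub>F\<^esub> inv\<^bsub>F\<^esub> u \<otimes>\<^bsub>F\<^esub> inv\<^bsub>F\<^esub> v)" using uF vF by (simp add: \<phi>.G.m_assoc)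
  then have "?c \<in> N" using N.inv_op_closed2[OF vF, of "inv\<^bsub>F\<^esub> u"] u by simp
  moreover have "?c \<in> ?K" using K.inv_op_closed2[OF uF v(1)] v(1) by simp
  moreover have "\<phi> ?c \<noteq> \<one>"
  proof
    assume "\<phi> ?c = \<one>"
    then have "x \<otimes> y \<otimes> inv x \<otimes> inv y = \<one>" using u v uF vF by simp
    then have "x \<otimes> y = y \<otimes> x"
      using noncomm by (metis inv_closed inv_equality inv_inv inv_solve_right m_closed)
    then show False using noncomm by simp
  qed
  ultimately have "\<phi> ` (N \<inter> ?K) \<noteq> {\<one>}" by blast
  then have "\<phi> ` (N \<inter> ?K) = carrier G" using dich[OF NK] by blast
  then show ?case using NK N(2) by blast
qed

lemma word_value_cong:
  assumes "\<And>i. i \<in> {1..d} \<Longrightarrow> g i = h i" and "w \<in> carrier (free_group d)"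
  shows "word_value G g w = word_value G h w"
proof -
  have "set w \<subseteq> {1..d} \<times> UNIV" using assms(2) by (simp add: free_group_def)
  then show ?thesis
  proof (induction w)
    case (Cons a w)
    then have "letter_value G g a = letter_value G h a"
      using assms(1) by (auto simp: letter_value_def)
    then show ?case using Cons by (simp add: word_value_def)
  qed (simp add: word_value_def)
qed

lemma (in group_hom) hom_word_value:
  assumes "g \<in> {1..d} \<rightarrow> carrier G" and "w \<in> carrier (free_group d)"
  shows "h (word_value G g w) = word_value H (\<lambda>i. h (g i)) w"
proof -
  have "set w \<subseteq> {1..d} \<times> UNIV" using assms(2) by (simp add: free_group_def)
  then show ?thesis
  proof (induction w)
    case (Cons a w)
    then have "h (letter_value G g a) = letter_value H (\<lambda>i. h (g i)) a"
      using assms(1) by (auto simp: letter_value_def Pi_iff)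
    moreover have "word_value G g (a # w) = letter_value G g a \<otimes> word_value G g w" for a w
      by (simp add: word_value_def)
    moreover have "letter_value G g a \<in> carrier G"
      using Cons.prems assms(1) by (intro G.letter_value_closed) auto
    moreover have "word_value G g w \<in> carrier G"
      using Cons.prems assms(1) by (intro G.word_value_closed) auto
    ultimately show ?case using Cons by (simp add: word_value_def)
  qed (simp add: word_value_def)
qed

lemma (in group) word_value_surj:
  assumes g: "g \<in> {1..d} \<rightarrow> carrier G" and gen: "generate G (g ` {1..d}) = carrier G"
  shows "word_value G g ` carrier (free_group d) = carrier G"
proof -
  interpret h: group_hom "free_group d" G "word_value G g"
    using word_value_hom[OF g] free_group_is_group is_group
    by (simp add: group_hom_def group_hom_axioms_def)
  have "g i \<in> word_value G g ` carrier (free_group d)" if "i \<in> {1..d}" for i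
  proof
    show "g i = word_value G g [(i, True)]" using g that by (intro word_value_generator[symmetric]) auto
    show "[(i, True)] \<in> carrier (free_group d)" using that by (simp add: free_group_def reduced_def)
  qed
  then have "g ` {1..d} \<subseteq> word_value G g ` carrier (free_group d)" by (rule image_subsetI)
  from generate_subgroup_incl[OF this h.img_is_subgroup]
  have "carrier G \<subseteq> word_value G g ` carrier (free_group d)" by (simp only: gen)
  then show ?thesis by (auto intro: h.hom_closed)
qed

text \<open>The tuples \<^term>\<open>h\<close> whose kernel is contained in that of the generating tuple \<^term>\<open>g\<close>
  are the images of \<^term>\<open>g\<close> under automorphisms. All other tuples, finitely many up to their
  values outside the index range, can be killed simultaneously by a word that takes an
  arbitrary prescribed value at \<^term>\<open>g\<close>. Word maps commute with automorphisms, so the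
  values on the orbit of \<^term>\<open>g\<close> are then forced.\<close>

theorem (in simple_group) ex_word_values_eq_automorphism_orbit:
  assumes noncomm: "x \<in> carrier G" "y \<in> carrier G" "x \<otimes> y \<noteq> y \<otimes> x"
    and fin: "finite (carrier G)"
    and g: "g \<in> {1..d} \<rightarrow> carrier G" and gen: "generate G (g ` {1..d}) = carrier G"
    and c: "c \<in> carrier G"
  shows "\<exists>w \<in> carrier (free_group d).
    word_values G d w = {\<one>} \<union> (\<Union>\<alpha> \<in> iso G G. {\<alpha> c, inv (\<alpha> c)})"
proof -
  let ?F = "free_group d" and ?\<phi> = "word_value G g"
  define T where "T = {h \<in> {1..d} \<rightarrow>\<^sub>E carrier G.
    \<not> kernel ?F G (word_value G h) \<subseteq> kernel ?F G ?\<phi>}"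
  have finT: "finite T" unfolding T_def using fin by (simp add: finite_PiE)
  have TD: "h \<in> {1..d} \<rightarrow> carrier G" if "h \<in> T" for h using that by (auto simp: T_def)
  have "\<exists>N. N \<lhd> ?F \<and> (\<forall>\<psi> \<in> word_value G ` T. N \<subseteq> kernel ?F G \<psi>) \<and> ?\<phi> ` N = carrier G"
    using noncomm free_group_is_group word_value_hom[OF g] word_value_surj[OF g gen] finite_imageI[OF finT]
  proof (rule ex_normal_in_kernels_onto)
    fix \<psi> assume "\<psi> \<in> word_value G ` T"
    then show "\<psi> \<in> hom ?F G \<and> \<not> kernel ?F G \<psi> \<subseteq> kernel ?F G ?\<phi>"
      using word_value_hom[OF TD] by (auto simp: T_def)
  qed
  then obtain N where N: "N \<lhd> ?F" "\<forall>\<psi> \<in> word_value G ` T. N \<subseteq> kernel ?F G \<psi>" "?\<phi> ` N = carrier G"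
    by blast
  obtain w where "w \<in> N" and wc: "?\<phi> w = c" using N(3) c by (metis imageE)
  have w: "w \<in> carrier ?F" using \<open>w \<in> N\<close> N(1) by (meson normal_imp_subgroup subgroup.mem_carrier)
  have automorphism: "group_hom G G \<alpha>" if "\<alpha> \<in> iso G G" for \<alpha>
    using that is_group by (simp add: group_hom_def group_hom_axioms_def iso_def)
  have value_cases: "word_value G h w = \<one> \<or> (\<exists>\<alpha> \<in> iso G G. word_value G h w = \<alpha> c)"
    if h: "h \<in> {1..d} \<rightarrow> carrier G" for h
  proof -
    let ?h = "restrict h {1..d}"
    have h': "?h \<in> {1..d} \<rightarrow>\<^sub>E carrier G" using h by auto
    then have hom: "word_value G ?h \<in> hom ?F G" by (intro word_value_hom) (auto simp: PiE_def)
    have eq: "word_value G h w = word_value G ?h w" by (rule word_value_cong[OF _ w]) simp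
    show ?thesis
    proof (cases "?h \<in> T")
      case True
      then have "word_value G ?h w = \<one>" using N(2) \<open>w \<in> N\<close> by (auto simp: kernel_def)
      then show ?thesis using eq by simp
    next
      case False
      then have "kernel ?F G (word_value G ?h) \<subseteq> kernel ?F G ?\<phi>" using h' by (simp add: T_def)
      then obtain \<alpha> where "\<alpha> \<in> iso G G" "\<forall>u \<in> carrier ?F. word_value G ?h u = \<alpha> (?\<phi> u)"
        using ex_automorphism_of_kernel_le[OF free_group_is_group word_value_hom[OF g] hom
            word_value_surj[OF g gen] fin] by blast
      then show ?thesis using eq w wc by auto
    qed
  qed
  have "\<one> \<in> word_values G d w"
  proof -
    have "word_value G (\<lambda>_. \<one>) w = \<one>" for w
      by (induction w) (auto simp: word_value_def letter_value_def)
    then show ?thesis by (auto simp: word_values_def intro!: bexI[of _ "\<lambda>_. \<one>"])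
  qed
  moreover have "{\<alpha> c, inv (\<alpha> c)} \<subseteq> word_values G d w" if \<alpha>: "\<alpha> \<in> iso G G" for \<alpha>
  proof -
    interpret \<alpha>: group_hom G G \<alpha> by (rule automorphism[OF \<alpha>])
    have "\<alpha> c = word_value G (\<lambda>i. \<alpha> (g i)) w" using \<alpha>.hom_word_value[OF g w] wc by simp
    moreover have "(\<lambda>i. \<alpha> (g i)) \<in> {1..d} \<rightarrow> carrier G" using g \<alpha>.hom_closed by (blast dest: PiE)
    then have "{word_value G (\<lambda>i. \<alpha> (g i)) w, inv (word_value G (\<lambda>i. \<alpha> (g i)) w)} \<subseteq> word_values G d w"
      unfolding word_values_def by (rule UN_upper)
    ultimately show ?thesis by (simp only:)
  qed
  moreover have "word_values G d w \<subseteq> {\<one>} \<union> (\<Union>\<alpha> \<in> iso G G. {\<alpha> c, inv (\<alpha> c)})"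
  proof
    fix z assume "z \<in> word_values G d w"
    then obtain h where "h \<in> {1..d} \<rightarrow> carrier G"
      and z: "z = word_value G h w \<or> z = inv (word_value G h w)"
      unfolding word_values_def by (elim UN_E insertE emptyE) blast+
    from value_cases[OF this(1)] z show "z \<in> {\<one>} \<union> (\<Union>\<alpha> \<in> iso G G. {\<alpha> c, inv (\<alpha> c)})"
      by auto
  qed
  ultimately show ?thesis using w by blast
qed

section \<open>Simplicity of the alternating groups\<close>

lemma three_cycleI:
  assumes "distinct [a, b, c]" "{a, b, c} \<subseteq> {1..n}"
  shows "cycle_of_list [a, b, c] \<in> three_cycles n"
proof -
  have "length [a, b, c] = 3" "set [a, b, c] \<subseteq> {1..n}" using assms by auto
  then show ?thesis using assms(1) by blast
qed

lemma three_cycleE: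
  assumes "p \<in> three_cycles n"
  obtains a b c where "p = cycle_of_list [a, b, c]" "distinct [a, b, c]" "{a, b, c} \<subseteq> {1..n}"
proof -
  obtain cs where cs: "p = cycle_of_list cs" "cycle cs" "length cs = 3" "set cs \<subseteq> {1..n}"
    using assms by blast
  moreover obtain a b c where "cs = [a, b, c]" using stupid_lemma[OF cs(3)] by blast
  ultimately show thesis using that by auto
qed

lemma three_cycle_in_alt_group:
  assumes "distinct [a, b, c]" "{a, b, c} \<subseteq> {1..n}"
  shows "cycle_of_list [a, b, c] \<in> carrier (alt_group n)"
  using three_cycles_incl three_cycleI[OF assms] by blast

lemma three_cycle_apply:
  assumes "distinct [a, b, c]"
  shows "cycle_of_list [a, b, c] a = b" "cycle_of_list [a, b, c] b = c" "cycle_of_list [a, b, c] c = a"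
    "x \<notin> {a, b, c} \<Longrightarrow> cycle_of_list [a, b, c] x = x"
  using assms by (auto simp: transpose_def)

declare cycle_of_list.simps [simp del]

lemma three_cycle_rotate:
  assumes "distinct [a, b, c]"
  shows "cycle_of_list [a, b, c] = cycle_of_list [b, c, a]"
  using cycle_of_list_rotate_independent[OF assms, of 1]
  by (simp only: rotate1.simps rotate_Suc rotate0 id_apply One_nat_def append.simps)

lemma three_cycle_comp_self:
  assumes abc: "distinct [a, b, c]"
  shows "cycle_of_list [a, b, c] \<circ> cycle_of_list [a, b, c] = cycle_of_list [c, b, a]"
proof
  have cba: "distinct [c, b, a]" using abc by auto
  fix x
  consider "x = a" | "x = b" | "x = c" | "x \<notin> {a, b, c}" by blast
  then show "(cycle_of_list [a, b, c] \<circ> cycle_of_list [a, b, c]) x = cycle_of_list [c, b, a] x"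
    by cases (simp_all add: three_cycle_apply[OF abc] three_cycle_apply[OF cba])
qed

lemma inv_three_cycle:
  assumes abc: "distinct [a, b, c]"
  shows "inv' (cycle_of_list [a, b, c]) = cycle_of_list [c, b, a]"
proof (rule inv_unique_comp; rule ext)
  have cba: "distinct [c, b, a]" using abc by auto
  fix x
  consider "x = a" | "x = b" | "x = c" | "x \<notin> {a, b, c}" by blast
  then show "(cycle_of_list [a, b, c] \<circ> cycle_of_list [c, b, a]) x = id x"
    by cases (simp_all add: three_cycle_apply[OF abc] three_cycle_apply[OF cba])
  consider "x = a" | "x = b" | "x = c" | "x \<notin> {a, b, c}" by blast
  then show "(cycle_of_list [c, b, a] \<circ> cycle_of_list [a, b, c]) x = id x"
    by cases (simp_all add: three_cycle_apply[OF abc] three_cycle_apply[OF cba])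
qed

lemma alt_group_bij: "p \<in> carrier (alt_group n) \<Longrightarrow> bij p"
  by (auto simp: alt_group_carrier intro: permutes_bij)

lemma conj_three_cycle:
  assumes "p \<in> carrier (alt_group n)" "distinct [a, b, c]"
  shows "p \<circ> cycle_of_list [a, b, c] \<circ> inv' p = cycle_of_list [p a, p b, p c]"
  using conjugation_of_cycle[OF assms(2) alt_group_bij[OF assms(1)]] by (simp only: list.map)

text \<open>Three transpositions carry one triple to the other. If the resulting permutation is odd,
  precomposing it with a transposition of two further points repairs the parity.\<close>

lemma three_cycles_conjugate:
  assumes n: "n \<ge> 5" and abc: "distinct [a, b, c]" "{a, b, c} \<subseteq> {1..n}"
    and xyz: "distinct [x, y, z]" "{x, y, z} \<subseteq> {1..n}"
  shows "\<exists>p \<in> carrier (alt_group n).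
    p \<circ> cycle_of_list [a, b, c] \<circ> inv' p = cycle_of_list [x, y, z]"
proof -
  define p1 where "p1 = transpose a x"
  define p2 where "p2 = transpose (p1 b) y \<circ> p1"
  define p3 where "p3 = transpose (p2 c) z \<circ> p2"
  have p1: "p1 permutes {1..n}" unfolding p1_def using abc xyz by (intro permutes_swap_id) auto
  have p1b: "p1 b \<in> {1..n}" using abc permutes_in_image[OF p1, of b] by blast
  have p2: "p2 permutes {1..n}" unfolding p2_def using p1 p1b xyz
    by (intro permutes_compose permutes_swap_id) auto
  have p2c: "p2 c \<in> {1..n}" using abc permutes_in_image[OF p2, of c] by blast
  have p3: "p3 permutes {1..n}" unfolding p3_def using p2 p2c xyz
    by (intro permutes_compose permutes_swap_id) auto
  have inj: "p1 u = p1 v \<longleftrightarrow> u = v" "p2 u = p2 v \<longleftrightarrow> u = v" for u v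
    using p1 p2 by (meson permutes_inj inj_eq)+
  have "p1 a = x" by (simp add: p1_def)
  then have "p2 a = x" "p2 b = y" using inj(1)[of a b] abc xyz by (auto simp: p2_def transpose_def)
  then have v: "p3 a = x" "p3 b = y" "p3 c = z"
    using inj(2)[of a c] inj(2)[of b c] abc xyz by (auto simp: p3_def transpose_def)
  have "card ({1..n} - {a, b, c}) = n - 3" using abc by (simp add: card_Diff_subset)
  then have "card ({1..n} - {a, b, c}) \<ge> 2" using n by simp
  then obtain T where "T \<subseteq> {1..n} - {a, b, c}" "card T = 2" by (meson obtain_subset_with_card_n)
  then obtain u v where uv: "u \<noteq> v" "{u, v} \<subseteq> {1..n} - {a, b, c}" by (auto simp: card_2_iff)
  define q where "q = (if evenperm p3 then p3 else p3 \<circ> transpose u v)"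
  have uvp: "transpose u v permutes {1..n}" using uv by (intro permutes_swap_id) auto
  have "permutation p3" using p3 by (auto simp: permutation_permutes)
  then have "evenperm q"
    using uv by (auto simp: q_def evenperm_comp evenperm_swap permutation_swap_id)
  moreover have "q permutes {1..n}" using p3 permutes_compose[OF uvp p3] by (simp add: q_def)
  ultimately have q: "q \<in> carrier (alt_group n)" by (simp add: alt_group_carrier)
  have "q a = x" "q b = y" "q c = z" using v uv by (auto simp: q_def transpose_def)
  then have "q \<circ> cycle_of_list [a, b, c] \<circ> inv' q = cycle_of_list [x, y, z]"
    using conj_three_cycle[OF q abc(1)] by (simp only:)
  then show ?thesis using q by blast
qed

lemma subgroup_alt_group_closed:
  assumes K: "subgroup K (alt_group n)"
  shows "p \<in> K \<Longrightarrow> p \<in> carrier (alt_group n)"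
    and "p \<in> K \<Longrightarrow> q \<in> K \<Longrightarrow> p \<circ> q \<in> K"
    and "p \<in> K \<Longrightarrow> inv' p \<in> K"
proof -
  show carrier: "p \<in> carrier (alt_group n)" if "p \<in> K" for p
    using subgroup.subset[OF K] that by blast
  show "p \<circ> q \<in> K" if "p \<in> K" "q \<in> K"
    using subgroup.m_closed[OF K that] by (simp only: alt_group_mult)
  show "inv' p \<in> K" if "p \<in> K"
    using subgroup.m_inv_closed[OF K that] by (simp only: alt_group_inv_equality[OF carrier[OF that]])
qed

lemma normal_alt_group_closed:
  assumes N: "N \<lhd> alt_group n" and p: "p \<in> N" and q: "q \<in> carrier (alt_group n)"
  shows "q \<circ> p \<circ> inv' q \<in> N" and "p \<circ> q \<circ> inv' p \<circ> inv' q \<in> N"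
proof -
  note closed = subgroup_alt_group_closed[OF normal_imp_subgroup[OF N]]
  have conj: "q \<circ> r \<circ> inv' q \<in> N" if "r \<in> N" for r
    using normal.inv_op_closed2[OF N q that] q by (simp add: alt_group_mult alt_group_inv_equality)
  show "q \<circ> p \<circ> inv' q \<in> N" by (rule conj[OF p])
  show "p \<circ> q \<circ> inv' p \<circ> inv' q \<in> N"
    using closed(2)[OF p conj[OF closed(3)[OF p]]] by (simp add: o_assoc)
qed

lemma normal_with_three_cycle:
  assumes "n \<ge> 5" and N: "N \<lhd> alt_group n"
    and abc: "cycle_of_list [a, b, c] \<in> N" "distinct [a, b, c]" "{a, b, c} \<subseteq> {1..n}"
  shows "N = carrier (alt_group n)"
proof -
  interpret A: group "alt_group n" by (rule alt_group_is_group)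
  have "three_cycles n \<subseteq> N"
  proof
    fix t assume "t \<in> three_cycles n"
    then obtain x y z where t: "t = cycle_of_list [x, y, z]" "distinct [x, y, z]" "{x, y, z} \<subseteq> {1..n}"
      by (rule three_cycleE)
    then obtain p where "p \<in> carrier (alt_group n)"
      "p \<circ> cycle_of_list [a, b, c] \<circ> inv' p = t"
      using three_cycles_conjugate[OF assms(1) abc(2,3) t(2,3)] by blast
    then show "t \<in> N" using normal_alt_group_closed(1)[OF N abc(1)] by blast
  qed
  then have "generate (alt_group n) (three_cycles n) \<subseteq> N"
    by (rule A.generate_subgroup_incl[OF _ normal_imp_subgroup[OF N]])
  then show ?thesis
    using alt_group_carrier_as_three_cycles subgroup.subset[OF normal_imp_subgroup[OF N]] by blast
qed

lemma ex_point_outside: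
  assumes "card S < n" "finite S"
  shows "\<exists>z::nat. z \<in> {1..n} - S"
proof (rule ccontr)
  assume "\<not> ?thesis"
  then have "{1..n} \<subseteq> S" by blast
  then have "card {1..n} \<le> card S" by (rule card_mono[OF assms(2)])
  then show False using assms(1) by simp
qed

text \<open>The commutator of \<^term>\<open>y\<close> with the 3-cycle \<open>(u v e)\<close> is the square of \<open>(v u e)\<close>,
  again a 3-cycle.\<close>

lemma normal_with_swap_and_fixed_point:
  assumes n: "n \<ge> 5" and N: "N \<lhd> alt_group n"
    and y: "y \<in> N" "y u = v" "y v = u" "y e = e"
    and d: "distinct [u, v, e]" "{u, v, e} \<subseteq> {1..n}"
  shows "N = carrier (alt_group n)"
proof -
  let ?c = "cycle_of_list [u, v, e]"
  note closed = subgroup_alt_group_closed[OF normal_imp_subgroup[OF N]]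
  have yA: "y \<in> carrier (alt_group n)" using closed(1)[OF y(1)] .
  have "y \<circ> ?c \<circ> inv' y = cycle_of_list [v, u, e]"
    using conj_three_cycle[OF yA d(1)] y by (simp only:)
  moreover have "y \<circ> ?c \<circ> inv' y \<circ> inv' ?c \<in> N"
    using normal_alt_group_closed(2)[OF N y(1) three_cycle_in_alt_group[OF d]] .
  ultimately have "cycle_of_list [v, u, e] \<circ> cycle_of_list [e, v, u] \<in> N"
    using inv_three_cycle[OF d(1)] by (simp only:)
  also have "cycle_of_list [v, u, e] \<circ> cycle_of_list [e, v, u] = cycle_of_list [u, v, e]"
  proof -
    have "distinct [v, u, e]" "distinct [e, v, u]" "distinct [e, u, v]" using d(1) by auto
    from three_cycle_comp_self[OF this(1)] three_cycle_rotate[OF this(2)] three_cycle_rotate[OF this(3)]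
    show ?thesis by (simp only:)
  qed
  finally show ?thesis using normal_with_three_cycle[OF n N _ d] by blast
qed

text \<open>Let \<open>v = y u\<close> and \<open>t = y v\<close>. If \<open>t = u\<close>, then \<^term>\<open>y\<close> itself swaps two points and fixes
  a third. Otherwise the commutator of \<^term>\<open>y\<close> with \<open>(u v z)\<close> is \<open>(v t z)(z v u)\<close>, the double
  transposition that swaps \<open>u\<close> with \<open>v\<close> and \<open>z\<close> with \<open>t\<close>, and a fifth point is fixed.\<close>

lemma normal_with_fixed_point:
  assumes n: "n \<ge> 5" and N: "N \<lhd> alt_group n"
    and y: "y \<in> N" "y u \<noteq> u" "y z = z" and z: "z \<in> {1..n}"
  shows "N = carrier (alt_group n)"
proof -
  note closed = subgroup_alt_group_closed[OF normal_imp_subgroup[OF N]]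
  have yA: "y \<in> carrier (alt_group n)" using closed(1)[OF y(1)] .
  then have perm: "y permutes {1..n}" by (simp add: alt_group_carrier)
  have inj: "y r = y s \<longleftrightarrow> r = s" for r s using perm by (meson permutes_inj inj_eq)
  define v t where "v = y u" and "t = y v"
  have u: "u \<in> {1..n}" using perm y(2) by (meson permutes_not_in)
  have v: "v \<in> {1..n}" and t: "t \<in> {1..n}"
    using permutes_in_image[OF perm] u unfolding v_def t_def by blast+
  have uvz: "distinct [u, v, z]" using inj[of u z] y by (auto simp: v_def)
  show ?thesis
  proof (cases "t = u")
    case True
    show ?thesis
      by (rule normal_with_swap_and_fixed_point[OF n N y(1) _ _ y(3) uvz])
        (use True u v z in \<open>auto simp: v_def t_def\<close>)
  next
    case False
    have tvz: "t \<noteq> v" "t \<noteq> z" using inj[of v u] inj[of v z] uvz y by (auto simp: t_def v_def)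
    let ?c = "cycle_of_list [u, v, z]"
    have "y \<circ> ?c \<circ> inv' y = cycle_of_list [v, t, z]"
      using conj_three_cycle[OF yA uvz] y(3) by (simp only: v_def t_def)
    moreover have "y \<circ> ?c \<circ> inv' y \<circ> inv' ?c \<in> N"
      using uvz u v z by (intro normal_alt_group_closed(2)[OF N] y(1) three_cycle_in_alt_group) auto
    ultimately have D: "cycle_of_list [v, t, z] \<circ> cycle_of_list [z, v, u] \<in> N" (is "?D \<in> N")
      using inv_three_cycle[OF uvz] by (simp only:)
    have "card {u, v, z, t} < n" using n by (simp add: card_insert_if)
    then obtain e where e: "e \<in> {1..n} - {u, v, z, t}" using ex_point_outside[of "{u, v, z, t}" n] by auto
    have vtz: "distinct [v, t, z]" and zvu: "distinct [z, v, u]" using uvz tvz by auto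
    have "?D u = v"
      using three_cycle_apply(3)[OF zvu] three_cycle_apply(3)[OF vtz] by simp
    moreover have "?D v = u"
      using three_cycle_apply(2)[OF zvu] three_cycle_apply(4)[OF vtz, of u] uvz False
      by simp
    moreover have "?D e = e"
      using three_cycle_apply(4)[OF zvu, of e] three_cycle_apply(4)[OF vtz, of e] e
      by simp
    moreover have "distinct [u, v, e]" "{u, v, e} \<subseteq> {1..n}" using uvz e u v by auto
    ultimately show ?thesis by (rule normal_with_swap_and_fixed_point[OF n N D])
  qed
qed

text \<open>By the previous lemma it is enough to find a nontrivial element with a fixed point in every
  nontrivial normal subgroup. If \<^term>\<open>x\<close> moves \<open>a\<close> to \<open>b\<close> and \<open>c\<close> is a 3-cycle through \<open>b\<close> but not
  through \<open>a\<close>, then \<open>inv x \<circ> c \<circ> x \<circ> inv c\<close> still moves \<open>a\<close>. It is a product of two 3-cycles,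
  hence moves at most six of the at least seven points.\<close>

lemma alt_group_simple:
  assumes n: "n \<ge> 7"
  shows "simple_group (alt_group n)"
proof -
  interpret A: group "alt_group n" by (rule alt_group_is_group)
  have fin: "finite (carrier (alt_group n))"
    using finite_permutations[of "{1..n}"] by (auto simp: alt_group_def elim: finite_subset[rotated])
  show ?thesis
  proof
    define t :: "nat \<Rightarrow> nat" where "t = cycle_of_list [1, 2, 3]"
    have "t 1 = 2" unfolding t_def by (intro three_cycle_apply(1)) simp
    then have "t \<noteq> id" by auto
    moreover have "t \<in> carrier (alt_group n)"
      unfolding t_def using n by (intro three_cycle_in_alt_group) auto
    moreover have "id \<in> carrier (alt_group n)" using A.one_closed by (simp add: alt_group_one)
    ultimately have "card {t, id} = 2" "{t, id} \<subseteq> carrier (alt_group n)" by auto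
    then show "1 < order (alt_group n)"
      unfolding order_def using card_mono[OF fin, of "{t, id}"] by linarith
  next
    fix N assume N: "N \<lhd> alt_group n"
    note closed = subgroup_alt_group_closed[OF normal_imp_subgroup[OF N]]
    show "N = carrier (alt_group n) \<or> N = {\<one>\<^bsub>alt_group n\<^esub>}"
    proof (cases "N \<subseteq> {id}")
      case True
      then show ?thesis using subgroup.one_closed[OF normal_imp_subgroup[OF N]] by (auto simp: alt_group_one)
    next
      case False
      then obtain x where "x \<in> N" "x \<noteq> id" by blast
      then obtain a where x: "x \<in> N" "x a \<noteq> a" by (auto simp: fun_eq_iff)
      define b where "b = x a"
      have xA: "x \<in> carrier (alt_group n)" using closed(1)[OF x(1)] .
      then have perm: "x permutes {1..n}" by (simp add: alt_group_carrier)
      have a: "a \<in> {1..n}" using perm x(2) by (meson permutes_not_in)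
      have b: "b \<in> {1..n}" unfolding b_def using permutes_in_image[OF perm] a by blast
      have "card {a, b} < n" using n by (simp add: card_insert_if)
      then obtain d where d: "d \<in> {1..n} - {a, b}" using ex_point_outside[of "{a, b}" n] by auto
      have "card {a, b, d} < n" using n by (simp add: card_insert_if)
      then obtain e where e: "e \<in> {1..n} - {a, b, d}" using ex_point_outside[of "{a, b, d}" n] by auto
      have bde: "distinct [b, d, e]" using d e by auto
      let ?c = "cycle_of_list [b, d, e]"
      have c: "?c \<in> carrier (alt_group n)" using bde b d e by (intro three_cycle_in_alt_group) auto
      define y where "y = inv' x \<circ> ?c \<circ> x \<circ> inv' ?c"
      have xx: "inv' x (x p) = p" "x (inv' x p) = p" for p
        using permutes_inverses[OF perm] by auto
      have yN: "y \<in> N"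
        using normal_alt_group_closed(2)[OF N closed(3)[OF x(1)] c] inv_inv_eq[OF alt_group_bij[OF xA]] by (simp add: y_def)
      have inv_c: "inv' ?c = cycle_of_list [e, d, b]" by (rule inv_three_cycle[OF bde])
      have "inv' ?c a = a" unfolding inv_c
        using bde d e x(2) by (intro three_cycle_apply(4)) (auto simp: b_def)
      then have "y a = inv' x d" using three_cycle_apply(1)[OF bde]
        by (simp add: y_def b_def[symmetric])
      moreover have "inv' x d \<noteq> a" using d xx(2)[of d] by (auto simp: b_def)
      ultimately have "y a \<noteq> a" by simp
      let ?S = "{b, d, e, inv' x b, inv' x d, inv' x e}"
      have "card ?S \<le> 6"
        using card_length[of "[b, d, e, inv' x b, inv' x d, inv' x e]"] by simp
      then have "card ?S < n" using n by linarith
      then obtain z where z: "z \<in> {1..n}" "z \<notin> ?S" using ex_point_outside[of ?S n] by blast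
      have "inv' ?c z = z" unfolding inv_c
        using bde z by (intro three_cycle_apply(4)) auto
      moreover have "?c (x z) = x z"
        using z xx(1)[of z] by (intro three_cycle_apply(4)[OF bde]) auto
      ultimately have "y z = z" using xx(1) by (simp add: y_def)
      then show ?thesis using normal_with_fixed_point[OF _ N yN \<open>y a \<noteq> a\<close> _ z(1)] n by simp
    qed
  qed
qed

section \<open>A generating pair for the alternating group\<close>

lemma three_cycle_in_subgroup_conj:
  assumes K: "subgroup K (alt_group n)" and d: "d \<in> K" and abc: "distinct [a, b, c]"
    and "cycle_of_list [d a, d b, d c] \<in> K"
  shows "cycle_of_list [a, b, c] \<in> K"
proof -
  note closed = subgroup_alt_group_closed[OF K]
  have bij: "bij d" using alt_group_bij[OF closed(1)[OF d]] .
  have "inv' d \<circ> cycle_of_list [d a, d b, d c] \<circ> d \<in> K"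
    by (intro closed d assms)
  also have "cycle_of_list [d a, d b, d c] = d \<circ> cycle_of_list [a, b, c] \<circ> inv' d"
    by (rule conj_three_cycle[OF closed(1)[OF d] abc, symmetric])
  also have "inv' d \<circ> (d \<circ> cycle_of_list [a, b, c] \<circ> inv' d) \<circ> d = cycle_of_list [a, b, c]"
    using bij by (simp add: fun_eq_iff bij_is_inj bij_is_surj surj_f_inv_f inv_f_f)
  finally show ?thesis .
qed

text \<open>Induction on the largest point: a 3-cycle \<open>(a b m+1)\<close> is conjugated into \<open>{1..m}\<close> by the
  given cycle \<open>d = (x y m+1)\<close> if \<open>y\<close> does not occur in it, by the inverse of \<open>d\<close> if \<open>x\<close> does not
  occur in it, and in the only remaining case it is \<open>d\<close> or its inverse.\<close>

lemma three_cycle_in_subgroup_of_chain: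
  assumes K: "subgroup K (alt_group n)" and start: "cycle_of_list [1, 2, 3] \<in> K"
    and chain: "\<And>m. 3 \<le> m \<Longrightarrow> m < n \<Longrightarrow>
      \<exists>x y. x \<noteq> y \<and> {x, y} \<subseteq> {1..m} \<and> cycle_of_list [x, y, Suc m] \<in> K"
    and "3 \<le> m" "m \<le> n" "distinct [a, b, c]" "{a, b, c} \<subseteq> {1..m}"
  shows "cycle_of_list [a, b, c] \<in> K"
  using assms(4-)
proof (induction m arbitrary: a b c rule: dec_induct)
  case base
  note inv = subgroup_alt_group_closed(3)[OF K]
  have 1: "cycle_of_list [2, 3, 1] \<in> K" using start three_cycle_rotate[of 1 2 "3::nat"] by simp
  have 2: "cycle_of_list [3, 1, 2] \<in> K" using 1 three_cycle_rotate[of 2 3 "1::nat"] by simp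
  note 3 = inv[OF start] inv[OF 1] inv[OF 2]
  have "a \<in> {1, 2, 3}" "b \<in> {1, 2, 3}" "c \<in> {1, 2, 3}" using base by auto
  then show ?case using start 1 2 3 base(2) by (auto simp: inv_three_cycle)
next
  case (step m)
  note closed = subgroup_alt_group_closed[OF K]
  obtain x y where xy: "x \<noteq> y" "{x, y} \<subseteq> {1..m}" and d: "cycle_of_list [x, y, Suc m] \<in> K"
    using chain[of m] step by auto
  have xym: "distinct [x, y, Suc m]" and myx: "distinct [Suc m, y, x]" using xy by auto
  have d': "cycle_of_list [Suc m, y, x] \<in> K" using closed(3)[OF d] inv_three_cycle[OF xym] by simp
  have top: "cycle_of_list [a, b, Suc m] \<in> K" if ab: "a \<noteq> b" "{a, b} \<subseteq> {1..m}" for a b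
  proof -
    have abm: "distinct [a, b, Suc m]" using ab by auto
    consider "y \<notin> {a, b}" | "x \<notin> {a, b}" | "x \<in> {a, b}" "y \<in> {a, b}" by blast
    then show ?thesis
    proof cases
      case 1
      let ?d = "cycle_of_list [x, y, Suc m]"
      have val: "?d z = (if z = x then y else z)" if "z \<in> {a, b}" for z
      proof (cases "z = x")
        case False
        then have "z \<notin> {x, y, Suc m}" using that 1 ab by auto
        then show ?thesis using three_cycle_apply(4)[OF xym] False by simp
      qed (simp add: three_cycle_apply(1)[OF xym])
      have "cycle_of_list [?d a, ?d b, ?d (Suc m)] \<in> K"
      proof (rule step.IH)
        show "distinct [?d a, ?d b, ?d (Suc m)]" "{?d a, ?d b, ?d (Suc m)} \<subseteq> {1..m}"
          using val[of a] val[of b] three_cycle_apply(3)[OF xym] 1 ab xy by auto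
      qed (use step in auto)
      then show ?thesis by (rule three_cycle_in_subgroup_conj[OF K d abm])
    next
      case 2
      let ?d = "cycle_of_list [Suc m, y, x]"
      have val: "?d z = (if z = y then x else z)" if "z \<in> {a, b}" for z
      proof (cases "z = y")
        case False
        then have "z \<notin> {Suc m, y, x}" using that 2 ab by auto
        then show ?thesis using three_cycle_apply(4)[OF myx] False by simp
      qed (simp add: three_cycle_apply(2)[OF myx])
      have "cycle_of_list [?d a, ?d b, ?d (Suc m)] \<in> K"
      proof (rule step.IH)
        show "distinct [?d a, ?d b, ?d (Suc m)]" "{?d a, ?d b, ?d (Suc m)} \<subseteq> {1..m}"
          using val[of a] val[of b] three_cycle_apply(1)[OF myx] 2 ab xy by auto
      qed (use step in auto)
      then show ?thesis by (rule three_cycle_in_subgroup_conj[OF K d' abm])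
    next
      case 3
      then have "a = x \<and> b = y \<or> a = y \<and> b = x" using xy(1) by auto
      then show ?thesis using d d' three_cycle_rotate[OF myx] by auto
    qed
  qed
  have abc: "distinct [a, b, c]" and sub: "{a, b, c} \<subseteq> {1..Suc m}" using step by auto
  have rot: "cycle_of_list [a, b, c] = cycle_of_list [b, c, a]"
    "cycle_of_list [a, b, c] = cycle_of_list [c, a, b]"
    using three_cycle_rotate[of a b c] three_cycle_rotate[of c a b] abc by auto
  consider "c = Suc m" | "a = Suc m" | "b = Suc m" | "Suc m \<notin> {a, b, c}" by blast
  then show ?case
  proof cases
    case 1
    have "{a, b} \<subseteq> {1..m}" using 1 abc sub by (auto simp: le_Suc_eq)
    then show ?thesis using top[of a b] 1 abc by simp
  next
    case 2
    have "{b, c} \<subseteq> {1..m}" using 2 abc sub by (auto simp: le_Suc_eq)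
    then show ?thesis using top[of b c] 2 abc rot(1) by simp
  next
    case 3
    have "{c, a} \<subseteq> {1..m}" using 3 abc sub by (auto simp: le_Suc_eq)
    then show ?thesis using top[of c a] 3 abc rot(2) by simp
  next
    case 4
    have "{a, b, c} \<subseteq> {1..m}" using 4 sub by (auto simp: le_Suc_eq)
    then show ?thesis using step.IH[OF _ abc] step by simp
  qed
qed

lemma cycle_of_upt_apply:
  assumes "s \<le> i" "i < n"
  shows "cycle_of_list [s..<Suc n] i = Suc i"
proof -
  let ?cs = "[s..<Suc n]" and ?k = "i - s"
  have k: "?k < length ?cs" "Suc ?k < length ?cs" using assms by auto
  have "map (cycle_of_list ?cs) ?cs = rotate1 ?cs" using cyclic_rotation[of ?cs 1] by simp
  then have "cycle_of_list ?cs (?cs ! ?k) = rotate1 ?cs ! ?k" using k by (metis nth_map)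
  also have "\<dots> = ?cs ! Suc ?k" using k by (simp add: nth_rotate1)
  finally show ?thesis using k assms by (simp del: upt_Suc)
qed

text \<open>The generator \<^term>\<open>\<sigma>\<close> is the longest cycle of odd length through consecutive points up to
  \<^term>\<open>n\<close>: it is \<open>(1 2 ... n)\<close> for odd \<^term>\<open>n\<close> and \<open>(2 3 ... n)\<close> for even \<^term>\<open>n\<close>. Its powers
  conjugate \<open>(1 2 3)\<close> to \<open>(i-1 i i+1)\<close> and to \<open>(1 i i+1)\<close> respectively, and either family is a
  chain as in the previous lemma.\<close>

lemma alt_group_two_generated:
  assumes n: "n \<ge> 3"
  shows "\<exists>\<sigma> \<in> carrier (alt_group n).
    generate (alt_group n) {\<sigma>, cycle_of_list [1, 2, 3]} = carrier (alt_group n)"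
proof -
  interpret A: group "alt_group n" by (rule alt_group_is_group)
  define s :: nat where "s = (if odd n then 1 else 2)"
  define \<sigma> where "\<sigma> = cycle_of_list [s..<Suc n]"
  let ?t = "cycle_of_list [1, 2, 3 :: nat]" and ?A = "alt_group n"
  let ?K = "generate ?A {\<sigma>, ?t}"
  have "even (length [s..<Suc n] - 1)" using n by (auto simp: s_def)
  moreover have "swapidseq (length [s..<Suc n] - 1) \<sigma>"
    unfolding \<sigma>_def by (rule swapidseq_ext_imp_swapidseq[OF swapidseq_ext_of_cycles]) simp
  ultimately have "evenperm \<sigma>" using evenperm_unique by blast
  moreover have "\<sigma> permutes {1..n}"
    unfolding \<sigma>_def by (rule permutes_subset[OF cycle_permutes]) (auto simp: s_def)
  ultimately have \<sigma>: "\<sigma> \<in> carrier ?A" by (simp only: alt_group_carrier)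
  have t: "?t \<in> carrier ?A" using n by (intro three_cycle_in_alt_group) auto
  have K: "subgroup ?K ?A" using \<sigma> t by (intro A.generate_is_subgroup) simp
  note closed = subgroup_alt_group_closed[OF K]
  have \<sigma>K: "\<sigma> \<in> ?K" and tK: "?t \<in> ?K" by (auto intro: generate.incl)
  define x where "x i = (if odd n then i - 1 else 1)" for i :: nat
  have chain: "i < n \<Longrightarrow> cycle_of_list [x i, i, Suc i] \<in> ?K" if "2 \<le> i" for i
    using that
  proof (induction i rule: dec_induct)
    case base
    have "[x 2, 2, Suc 2] = [1, 2, 3]" by (simp add: x_def)
    then show ?case using tK by (simp only:)
  next
    case (step i)
    have "\<sigma> (x i) = x (Suc i)"
    proof (cases "odd n")
      case True
      then show ?thesis using step cycle_of_upt_apply[of 1 "i - 1" n] by (simp add: \<sigma>_def x_def s_def)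
    next
      case False
      then show ?thesis by (simp add: \<sigma>_def x_def s_def id_outside_supp)
    qed
    moreover have "\<sigma> i = Suc i" "\<sigma> (Suc i) = Suc (Suc i)"
      using step by (auto simp: \<sigma>_def s_def cycle_of_upt_apply simp del: upt_Suc)
    moreover have "distinct [x i, i, Suc i]" using step by (auto simp: x_def)
    ultimately have "\<sigma> \<circ> cycle_of_list [x i, i, Suc i] \<circ> inv' \<sigma>
        = cycle_of_list [x (Suc i), Suc i, Suc (Suc i)]"
      using conj_three_cycle[OF \<sigma>, of "x i" i "Suc i"] by (simp only:)
    moreover have "\<sigma> \<circ> cycle_of_list [x i, i, Suc i] \<circ> inv' \<sigma> \<in> ?K"
      using step by (intro closed \<sigma>K) auto
    ultimately show ?case by simp
  qed
  have "three_cycles n \<subseteq> ?K"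
  proof
    fix p assume "p \<in> three_cycles n"
    then obtain a b c where p: "p = cycle_of_list [a, b, c]" "distinct [a, b, c]" "{a, b, c} \<subseteq> {1..n}"
      by (rule three_cycleE)
    have "\<exists>x y. x \<noteq> y \<and> {x, y} \<subseteq> {1..m} \<and> cycle_of_list [x, y, Suc m] \<in> ?K"
      if "3 \<le> m" "m < n" for m
      using that chain[of m] by (intro exI[of _ "x m"] exI[of _ m]) (auto simp: x_def)
    from three_cycle_in_subgroup_of_chain[OF K tK this n order_refl p(2,3)]
    show "p \<in> ?K" by (simp only: p(1))
  qed
  then have "generate ?A (three_cycles n) \<subseteq> ?K" by (rule A.generate_subgroup_incl[OF _ K])
  then have "?K = carrier ?A"
    using alt_group_carrier_as_three_cycles[of n] closed(1) by blast
  then show ?thesis using \<sigma> by blast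
qed



section \<open>Automorphisms preserve 3-cycles\<close>

lemma cycle_of_list_append_shared:
  "cycle_of_list (xs @ [a]) \<circ> cycle_of_list (a # ys) = cycle_of_list (xs @ a # ys)"
  by (induction xs rule: cycle_of_list.induct) (auto simp: cycle_of_list.simps o_assoc[symmetric] fun_eq_iff)

lemma three_cycle_funpow_three:
  assumes "distinct [a, b, c]"
  shows "cycle_of_list [a, b, c] ^^ 3 = id"
  using cycle_is_id_root[OF assms] by (simp add: eval_nat_numeral)

text \<open>Two 3-cycles multiply to a 5-cycle if they share one point. If they share two points they
  multiply to a 3-cycle or to a double transposition, according to whether they move the shared
  pair in opposite directions or not. If they share all three points they are equal or inverse
  to each other. Rotating the cycles brings every case into one of these forms.\<close>

lemma order_of_three_cycles_sharing_point:
  assumes abc: "distinct [a, b, c]" and apq: "distinct [a, p, q]"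
  defines "y \<equiv> cycle_of_list [a, b, c] \<circ> cycle_of_list [a, p, q]"
  shows "y ^^ 2 = id \<or> y ^^ 3 = id \<or> y ^^ 5 = id"
proof -
  have one_point: "(cycle_of_list [u, v, w] \<circ> cycle_of_list [w, s, t]) ^^ 5 = id"
    if "distinct [u, v, w, s, t]" for u v w s t :: 'a
    using cycle_is_id_root[OF that] cycle_of_list_append_shared[of "[u, v]" w "[s, t]"]
    by (simp add: eval_nat_numeral)
  have opposite: "(cycle_of_list [u, v, w] \<circ> cycle_of_list [w, v, s]) ^^ 3 = id"
    if "distinct [u, v, w, s]" for u v w s :: 'a
  proof -
    have "cycle_of_list [u, v, w] \<circ> cycle_of_list [w, v, s] = cycle_of_list [u, v, s]"
      by (simp add: cycle_of_list.simps transpose_commute[of w v] fun_eq_iff)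
    then show ?thesis using that three_cycle_funpow_three[of u v s] by simp
  qed
  have parallel: "(cycle_of_list [u, v, w] \<circ> cycle_of_list [w, s, v]) ^^ 2 = id"
    if "distinct [u, v, w, s]" for u v w s :: 'a
  proof -
    have "cycle_of_list [w, s, v] = cycle_of_list [v, w, s]"
      using that three_cycle_rotate[of v w s] by auto
    then have *: "cycle_of_list [u, v, w] \<circ> cycle_of_list [w, s, v] = transpose u v \<circ> transpose w s"
      by (simp add: cycle_of_list.simps fun_eq_iff)
    have "transpose u v (transpose w s x) = transpose w s (transpose u v x)" for x
      using that by (auto simp: transpose_def)
    then show ?thesis unfolding * by (simp add: eval_nat_numeral fun_eq_iff)
  qed
  have "cycle_of_list [a, b, c] = cycle_of_list [b, c, a]"
     "cycle_of_list [b, c, a] = cycle_of_list [c, a, b]"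
     "cycle_of_list [a, p, q] = cycle_of_list [p, q, a]"
     "cycle_of_list [p, q, a] = cycle_of_list [q, a, p]"
    using abc apq by (auto intro!: three_cycle_rotate)
  then have y: "y = cycle_of_list [b, c, a] \<circ> cycle_of_list [a, p, q]"
    "y = cycle_of_list [c, a, b] \<circ> cycle_of_list [p, q, a]"
    "y = cycle_of_list [c, a, b] \<circ> cycle_of_list [q, a, p]"
    by (simp_all only: y_def)
  consider "p = b" "q = c" | "p = b" "q \<notin> {a, b, c}" | "p = c" "q = b" | "p = c" "q \<notin> {a, b, c}"
    | "p \<notin> {a, b, c}" "q = b" | "p \<notin> {a, b, c}" "q = c" | "p \<notin> {a, b, c}" "q \<notin> {a, b, c}"
    using apq by auto
  then show ?thesis
  proof cases
    case 1
    have "distinct [c, b, a]" using abc by auto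
    then show ?thesis
      using three_cycle_comp_self[OF abc] three_cycle_funpow_three[of c b a] 1 by (simp add: y_def)
  next
    case 2
    then have "distinct [c, a, b, q]" using abc apq by auto
    moreover have "y = cycle_of_list [c, a, b] \<circ> cycle_of_list [b, q, a]" using 2 y(2) by simp
    ultimately show ?thesis using parallel by blast
  next
    case 3
    have "cycle_of_list [c, b, a] = cycle_of_list [b, a, c]"
      "cycle_of_list [b, a, c] = cycle_of_list [a, c, b]"
      using abc by (auto intro!: three_cycle_rotate)
    then have "y = cycle_of_list [a, b, c] \<circ> inv' (cycle_of_list [a, b, c])"
      by (simp only: 3 y_def inv_three_cycle[OF abc])
    also have "\<dots> = id" using permutes_inv_o(1)[OF cycle_permutes] by blast
    finally show ?thesis by simp
  next
    case 4
    then have "distinct [b, c, a, q]" using abc apq by auto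
    moreover have "y = cycle_of_list [b, c, a] \<circ> cycle_of_list [a, c, q]" using 4 y(1) by simp
    ultimately show ?thesis using opposite by blast
  next
    case 5
    then have "distinct [c, a, b, p]" using abc apq by auto
    moreover have "y = cycle_of_list [c, a, b] \<circ> cycle_of_list [b, a, p]" using 5 y(3) by simp
    ultimately show ?thesis using opposite by blast
  next
    case 6
    then have "distinct [b, c, a, p]" using abc apq by auto
    moreover have "y = cycle_of_list [b, c, a] \<circ> cycle_of_list [a, p, c]" using 6 y(1) by simp
    ultimately show ?thesis using parallel by blast
  next
    case 7
    then have "distinct [b, c, a, p, q]" using abc apq by auto
    then show ?thesis using one_point y(1) by blast
  qed
qed

lemma order_of_product_of_three_cycles:
  assumes abc: "distinct [a, b, c]" and pqr: "distinct [p, q, r]"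
  defines "y \<equiv> cycle_of_list [a, b, c] \<circ> cycle_of_list [p, q, r]"
  shows "y ^^ 2 = id \<or> y ^^ 3 = id \<or> y ^^ 5 = id"
proof (cases "{a, b, c} \<inter> {p, q, r} = {}")
  case True
  let ?c = "cycle_of_list [a, b, c]" and ?d = "cycle_of_list [p, q, r]"
  have "?c \<circ> ?d = ?d \<circ> ?c" using cycles_commute[OF abc pqr] True by simp
  then have comm: "?c (?d x) = ?d (?c x)" for x by (simp add: fun_eq_iff)
  have "?c (?c (?c x)) = x" "?d (?d (?d x)) = x" for x
    using three_cycle_funpow_three[OF abc] three_cycle_funpow_three[OF pqr]
    by (auto simp: fun_eq_iff eval_nat_numeral)
  then have "y ^^ 3 = id" by (simp add: y_def fun_eq_iff eval_nat_numeral comm)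
  then show ?thesis by simp
next
  case False
  have rot: "cycle_of_list [a, b, c] = cycle_of_list [b, c, a]"
    "cycle_of_list [a, b, c] = cycle_of_list [c, a, b]"
    "cycle_of_list [p, q, r] = cycle_of_list [q, r, p]"
    "cycle_of_list [p, q, r] = cycle_of_list [r, p, q]"
    using three_cycle_rotate[of a b c] three_cycle_rotate[of c a b]
      three_cycle_rotate[of p q r] three_cycle_rotate[of r p q] abc pqr by auto
  obtain w where w: "w \<in> {a, b, c}" "w \<in> {p, q, r}" using False by blast
  obtain u v where uv: "cycle_of_list [a, b, c] = cycle_of_list [w, u, v]" "distinct [w, u, v]"
  proof -
    consider "w = a" | "w = b" | "w = c" using w(1) by blast
    then show thesis
      by cases (use that rot abc in \<open>force+\<close>)
  qed
  obtain s t where st: "cycle_of_list [p, q, r] = cycle_of_list [w, s, t]" "distinct [w, s, t]"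
  proof -
    consider "w = p" | "w = q" | "w = r" using w(2) by blast
    then show thesis
      by cases (use that rot pqr in \<open>force+\<close>)
  qed
  show ?thesis
    using order_of_three_cycles_sharing_point[OF uv(2) st(2)] uv(1) st(1) by (simp only: y_def)
qed

lemma comp_conj_apply:
  assumes "g \<in> carrier (alt_group n)"
  shows "(x \<circ> (g \<circ> x \<circ> inv' g)) (g u) = x (g (x u))"
  using alt_group_bij[OF assms] by (simp add: bij_is_inj)

text \<open>A permutation of order 3 with at least two cycles \<open>(a a1 a2)\<close> and \<open>(b b1 b2)\<close>, together with
  a seventh point \<open>f\<close>. If \<open>f\<close> is fixed, conjugating with \<open>(a b f)\<close> gives a product that contains the
  cycles \<open>(a a1)\<close> and \<open>(a2 b1 b)\<close>. If \<open>f\<close> is moved, conjugating with \<open>(a a1 b)\<close> gives a product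
  that contains the 5-cycle \<open>(a b2 a1 b1 b)\<close> and acts on the cycle of \<open>f\<close> as the square of
  \<^term>\<open>x\<close>. In both cases none of the powers 2, 3 and 5 of the product is trivial.\<close>

lemma ex_conjugate_with_bad_product:
  assumes n: "n \<ge> 7" and x: "x \<in> carrier (alt_group n)" "x ^^ 3 = id" "x \<noteq> id"
    and not_cycle: "x \<notin> three_cycles n"
  shows "\<exists>g \<in> carrier (alt_group n). let y = x \<circ> (g \<circ> x \<circ> inv' g) in
    y ^^ 2 \<noteq> id \<and> y ^^ 3 \<noteq> id \<and> y ^^ 5 \<noteq> id"
proof -
  have perm: "x permutes {1..n}" using x(1) by (simp add: alt_group_carrier)
  have inj: "x u = x v \<longleftrightarrow> u = v" for u v using perm by (meson permutes_inj inj_eq)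
  have moved: "u \<in> {1..n}" if "x u \<noteq> u" for u using that perm by (meson permutes_not_in)
  have cube: "x (x (x u)) = u" for u using x(2) by (simp add: fun_eq_iff eval_nat_numeral)
  have orbit: "distinct [u, x u, x (x u)] \<and> {u, x u, x (x u)} \<subseteq> {1..n}" if "x u \<noteq> u" for u
  proof -
    have "x (x u) \<noteq> x u" using that inj by simp
    moreover have "x (x u) \<noteq> u" using that cube[of u] by metis
    ultimately show ?thesis using that cube[of u] moved[of u] moved[of "x u"] moved[of "x (x u)"] by auto
  qed
  obtain a where a: "x a \<noteq> a" using x(3) by (auto simp: fun_eq_iff)
  define a1 a2 where "a1 = x a" and "a2 = x a1"
  have xa: "x a = a1" "x a1 = a2" "x a2 = a" using cube[of a] by (simp_all add: a1_def a2_def)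
  have da: "distinct [a, a1, a2]" "{a, a1, a2} \<subseteq> {1..n}" using orbit[OF a] by (auto simp: a1_def a2_def)
  have "\<exists>b. x b \<noteq> b \<and> b \<notin> {a, a1, a2}"
  proof (rule ccontr)
    assume H: "\<not> ?thesis"
    have eq: "x = cycle_of_list [a, a1, a2]"
    proof
      fix u
      consider "u = a" | "u = a1" | "u = a2" | "u \<notin> {a, a1, a2}" by blast
      then show "x u = cycle_of_list [a, a1, a2] u"
        by cases (use H xa three_cycle_apply[OF da(1)] in auto)
    qed
    show False by (rule notE[OF not_cycle]) (subst eq, rule three_cycleI[OF da])
  qed
  then obtain b where b: "x b \<noteq> b" "b \<notin> {a, a1, a2}" by blast
  define b1 b2 where "b1 = x b" and "b2 = x b1"
  have xb: "x b = b1" "x b1 = b2" "x b2 = b" using cube[of b] by (simp_all add: b1_def b2_def)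
  have db: "distinct [b, b1, b2]" "{b, b1, b2} \<subseteq> {1..n}" using orbit[OF b(1)] by (auto simp: b1_def b2_def)
  have b1: "b1 \<notin> {a, a1, a2}" using inj[of b a2] inj[of b a] inj[of b a1] b(2) xa by (auto simp: b1_def)
  have b2: "b2 \<notin> {a, a1, a2}" using inj[of b1 a2] inj[of b1 a] inj[of b1 a1] b1 xa by (auto simp: b2_def)
  let ?S = "{a, a1, a2, b, b1, b2}"
  have "card ?S \<le> 6" using card_length[of "[a, a1, a2, b, b1, b2]"] by simp
  then have "card ?S < n" using n by linarith
  then obtain f where f: "f \<in> {1..n}" "f \<notin> ?S" using ex_point_outside[of ?S n] by blast
  have ab: "distinct [a, a1, a2, b, b1, b2]" using da db b b1 b2 by auto
  show ?thesis
  proof (cases "x f = f")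
    case True
    let ?g = "cycle_of_list [a, b, f]"
    have abf: "distinct [a, b, f]" using ab f by auto
    have g: "?g \<in> carrier (alt_group n)"
      using abf da(2) db(2) f by (intro three_cycle_in_alt_group) auto
    define y where "y = x \<circ> (?g \<circ> x \<circ> inv' ?g)"
    have y: "y (?g u) = x (?g (x u))" for u unfolding y_def by (rule comp_conj_apply[OF g])
    have "?g a1 = a1" "?g a2 = a2" "?g b1 = b1" "?g b2 = b2"
      using ab f by (auto intro!: three_cycle_apply(4)[OF abf])
    note gv = this three_cycle_apply(1-3)[OF abf]
    have "y a = a1" "y a1 = a" "y a2 = b1" "y b1 = b" "y b = a2"
      using y[of f] y[of a1] y[of a2] y[of b1] y[of a] by (simp_all add: gv xa xb True)
    then have "(y ^^ 2) a2 \<noteq> a2" "(y ^^ 3) a \<noteq> a" "(y ^^ 5) a \<noteq> a"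
      using ab by (auto simp: eval_nat_numeral)
    then have "y ^^ 2 \<noteq> id" "y ^^ 3 \<noteq> id" "y ^^ 5 \<noteq> id" by (metis id_apply)+
    then show ?thesis using g by (auto simp: y_def Let_def)
  next
    case False
    let ?g = "cycle_of_list [a, a1, b]"
    have aab: "distinct [a, a1, b]" using ab f by auto
    have g: "?g \<in> carrier (alt_group n)"
      using aab da(2) db(2) f by (intro three_cycle_in_alt_group) auto
    define y where "y = x \<circ> (?g \<circ> x \<circ> inv' ?g)"
    have y: "y (?g u) = x (?g (x u))" for u unfolding y_def by (rule comp_conj_apply[OF g])
    have outside: "x u \<notin> ?S" if "u \<notin> ?S" for u
      using that inj[of u a] inj[of u a1] inj[of u a2] inj[of u b] inj[of u b1] inj[of u b2]
      by (auto simp: xa xb)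
    have yf: "y u = x (x u)" if "u \<notin> ?S" for u
    proof -
      have "?g u = u" "?g (x u) = x u"
        using that outside[OF that] by (auto intro!: three_cycle_apply(4)[OF aab])
      then show ?thesis using y[of u] by simp
    qed
    have "(y ^^ 5) f = x f"
      using f(2) outside[OF f(2)] outside[OF outside[OF f(2)]] cube
      by (simp add: eval_nat_numeral yf del: insert_iff)
    then have five: "y ^^ 5 \<noteq> id" using False by (metis id_apply)
    have "?g a2 = a2" "?g b1 = b1" "?g b2 = b2"
      using ab by (auto intro!: three_cycle_apply(4)[OF aab])
    note gv = this three_cycle_apply(1-3)[OF aab]
    have "y a = b2" "y b2 = a1" "y a1 = b1" "y b1 = b" "y b = a"
      using y[of b] y[of b2] y[of a] y[of b1] y[of a1] by (simp_all add: gv xa xb)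
    then have "(y ^^ 2) a \<noteq> a" "(y ^^ 3) a \<noteq> a" using ab by (auto simp: eval_nat_numeral)
    then have "y ^^ 2 \<noteq> id" "y ^^ 3 \<noteq> id" by (metis id_apply)+
    then show ?thesis using g five by (auto simp: y_def Let_def)
  qed
qed

text \<open>The point of this characterisation is that its right-hand side speaks only of the group
  structure, so every automorphism respects it.\<close>

lemma three_cycle_iff:
  assumes n: "n \<ge> 7" and x: "x \<in> carrier (alt_group n)"
  shows "x \<in> three_cycles n \<longleftrightarrow> x \<noteq> id \<and> x ^^ 3 = id \<and>
    (\<forall>g \<in> carrier (alt_group n). let y = x \<circ> (g \<circ> x \<circ> inv' g) in
      y ^^ 2 = id \<or> y ^^ 3 = id \<or> y ^^ 5 = id)"
proof
  assume "x \<in> three_cycles n"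
  then obtain a b c where abc: "x = cycle_of_list [a, b, c]" "distinct [a, b, c]" by (rule three_cycleE)
  have "x a \<noteq> a" using three_cycle_apply(1)[OF abc(2)] abc by auto
  moreover have "x ^^ 3 = id" using three_cycle_funpow_three[OF abc(2)] abc(1) by simp
  moreover have "let y = x \<circ> (g \<circ> x \<circ> inv' g) in y ^^ 2 = id \<or> y ^^ 3 = id \<or> y ^^ 5 = id"
    if g: "g \<in> carrier (alt_group n)" for g
  proof -
    have "distinct (map g [a, b, c])"
      using abc(2) by (simp add: inj_eq[OF bij_is_inj[OF alt_group_bij[OF g]]])
    then show ?thesis
      using order_of_product_of_three_cycles[OF abc(2), of "g a" "g b" "g c"]
        conj_three_cycle[OF g abc(2)] abc(1) by (simp only: Let_def list.map)
  qed
  ultimately show "x \<noteq> id \<and> x ^^ 3 = id \<and>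
    (\<forall>g \<in> carrier (alt_group n). let y = x \<circ> (g \<circ> x \<circ> inv' g) in
      y ^^ 2 = id \<or> y ^^ 3 = id \<or> y ^^ 5 = id)" by auto
next
  assume "x \<noteq> id \<and> x ^^ 3 = id \<and>
    (\<forall>g \<in> carrier (alt_group n). let y = x \<circ> (g \<circ> x \<circ> inv' g) in
      y ^^ 2 = id \<or> y ^^ 3 = id \<or> y ^^ 5 = id)"
  then show "x \<in> three_cycles n"
    using ex_conjugate_with_bad_product[OF n x] unfolding Let_def by blast
qed

lemma automorphism_three_cycle:
  assumes n: "n \<ge> 7" and \<alpha>: "\<alpha> \<in> iso (alt_group n) (alt_group n)" and x: "x \<in> three_cycles n"
  shows "\<alpha> x \<in> three_cycles n"
proof -
  let ?A = "carrier (alt_group n)"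
  interpret \<alpha>: group_hom "alt_group n" "alt_group n" \<alpha>
    using \<alpha> alt_group_is_group by (simp add: group_hom_def group_hom_axioms_def iso_def)
  have bij: "bij_betw \<alpha> ?A ?A" using \<alpha> by (simp add: iso_def)
  have xA: "x \<in> ?A" using x three_cycles_incl by blast
  have comp: "p \<circ> q \<in> ?A" "\<alpha> (p \<circ> q) = \<alpha> p \<circ> \<alpha> q" if "p \<in> ?A" "q \<in> ?A" for p q
    using \<alpha>.G.m_closed[OF that] \<alpha>.hom_mult[OF that] by (simp_all only: alt_group_mult)
  have id: "id \<in> ?A" "\<alpha> id = id"
    using \<alpha>.G.one_closed \<alpha>.hom_one by (simp_all only: alt_group_one)
  have inv: "inv' p \<in> ?A" "\<alpha> (inv' p) = inv' (\<alpha> p)" if "p \<in> ?A" for p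
    using \<alpha>.G.inv_closed[OF that] \<alpha>.hom_inv[OF that]
    by (simp_all only: alt_group_inv_equality that \<alpha>.hom_closed)
  have pow: "p ^^ k \<in> ?A \<and> \<alpha> (p ^^ k) = \<alpha> p ^^ k" if "p \<in> ?A" for p k
  proof (induction k)
    case (Suc k)
    then show ?case using comp[OF that, of "p ^^ k"] by (simp only: funpow.simps simp_thms)
  qed (simp only: funpow.simps id simp_thms)
  have pow_id: "\<alpha> p ^^ k = id \<longleftrightarrow> p ^^ k = id" if "p \<in> ?A" for p k
    using pow[OF that, of k] id bij by (metis bij_betw_inv_into_left)
  have char: "x \<noteq> id" "x ^^ 3 = id" "\<And>g. g \<in> ?A \<Longrightarrow> let y = x \<circ> (g \<circ> x \<circ> inv' g) in
      y ^^ 2 = id \<or> y ^^ 3 = id \<or> y ^^ 5 = id"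
    using x three_cycle_iff[OF n xA] by blast+
  have "\<alpha> x \<noteq> id" "\<alpha> x ^^ 3 = id" using char pow_id[OF xA, of 1] pow_id[OF xA, of 3] by auto
  moreover have "let y = \<alpha> x \<circ> (h \<circ> \<alpha> x \<circ> inv' h) in
      y ^^ 2 = id \<or> y ^^ 3 = id \<or> y ^^ 5 = id" if "h \<in> ?A" for h
  proof -
    have "h \<in> \<alpha> ` ?A" using that bij by (simp only: bij_betw_def)
    then obtain g where g: "h = \<alpha> g" "g \<in> ?A" by (rule imageE)
    let ?y = "x \<circ> (g \<circ> x \<circ> inv' g)"
    have inner: "g \<circ> x \<in> ?A" "g \<circ> x \<circ> inv' g \<in> ?A"
      using comp(1)[OF g(2) xA] comp(1)[OF _ inv(1)[OF g(2)]] by blast+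
    have y: "?y \<in> ?A" by (rule comp(1)[OF xA inner(2)])
    have "\<alpha> ?y = \<alpha> x \<circ> (h \<circ> \<alpha> x \<circ> inv' h)"
      by (simp only: comp(2)[OF xA inner(2)] comp(2)[OF inner(1) inv(1)[OF g(2)]]
          comp(2)[OF g(2) xA] inv(2)[OF g(2)] g(1))
    then show ?thesis using char(3)[OF g(2)] pow_id[OF y] by (simp only: Let_def)
  qed
  moreover have "\<alpha> x \<in> ?A" using xA by (rule \<alpha>.hom_closed)
  ultimately show ?thesis using three_cycle_iff[OF n, of "\<alpha> x"] by blast
qed

section \<open>Words whose values are the 3-cycles\<close>

lemma (in group) conjugation_iso:
  assumes p: "p \<in> carrier G"
  shows "(\<lambda>x. p \<otimes> x \<otimes> inv p) \<in> iso G G"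
proof -
  have cancel: "p \<otimes> (inv p \<otimes> a) = a" "inv p \<otimes> (p \<otimes> a) = a" if "a \<in> carrier G" for a
    using p that by (simp_all add: m_assoc[symmetric])
  have "bij_betw (\<lambda>x. p \<otimes> x \<otimes> inv p) (carrier G) (carrier G)"
    by (rule bij_betw_byWitness[of _ "\<lambda>x. inv p \<otimes> x \<otimes> p"])
      (use p in \<open>auto simp: m_assoc cancel\<close>)
  moreover have "p \<otimes> (x \<otimes> y) \<otimes> inv p = (p \<otimes> x \<otimes> inv p) \<otimes> (p \<otimes> y \<otimes> inv p)"
    if "x \<in> carrier G" "y \<in> carrier G" for x y
    using p that by (simp add: m_assoc cancel)
  ultimately show ?thesis using p by (auto simp: iso_def hom_def)
qed

lemma ex_word_with_values_three_cycles:
  assumes n: "n \<ge> 7" and d: "d \<ge> 2"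
  shows "\<exists>w \<in> carrier (free_group d).
    word_values (alt_group n) d w = {\<one>\<^bsub>alt_group n\<^esub>} \<union> three_cycles n"
proof -
  let ?G = "alt_group n" and ?c = "cycle_of_list [1, 2, 3 :: nat]" and ?e = "cycle_of_list [2, 3, 4 :: nat]"
  interpret simple_group ?G by (rule alt_group_simple[OF n])
  have fin: "finite (carrier ?G)" using order_gt_0_iff_finite order_gt_one by simp
  have c: "distinct [1, 2, 3 :: nat]" "{1, 2, 3} \<subseteq> {1..n}"
    and e: "distinct [2, 3, 4 :: nat]" "{2, 3, 4} \<subseteq> {1..n}" using n by auto
  note cG = three_cycle_in_alt_group[OF c] and eG = three_cycle_in_alt_group[OF e]
  have "(?c \<circ> ?e) 1 = 2" "(?e \<circ> ?c) 1 = 3"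
    using three_cycle_apply(1)[OF c(1)] three_cycle_apply(1)[OF e(1)] three_cycle_apply(4)[OF e(1), of 1]
    by simp_all
  then have "(?c \<circ> ?e) 1 \<noteq> (?e \<circ> ?c) 1" by presburger
  then have "?c \<otimes>\<^bsub>?G\<^esub> ?e \<noteq> ?e \<otimes>\<^bsub>?G\<^esub> ?c" unfolding alt_group_mult by metis
  note noncomm = cG eG this
  obtain \<sigma> where \<sigma>: "\<sigma> \<in> carrier ?G" "generate ?G {\<sigma>, ?c} = carrier ?G"
    using alt_group_two_generated[of n] n by auto
  define g where "g i = (if i = (1::nat) then \<sigma> else ?c)" for i
  have g: "g \<in> {1..d} \<rightarrow> carrier ?G" using \<sigma>(1) cG by (simp add: g_def)
  have "g ` {1..d} = {\<sigma>, ?c}"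
  proof
    have "{g 1, g 2} \<subseteq> g ` {1..d}" using d by auto
    then show "{\<sigma>, ?c} \<subseteq> g ` {1..d}" by (simp add: g_def)
  qed (auto simp: g_def)
  then have gen: "generate ?G (g ` {1..d}) = carrier ?G" using \<sigma>(2) by simp
  obtain w where w: "w \<in> carrier (free_group d)"
    "word_values ?G d w = {\<one>\<^bsub>?G\<^esub>} \<union> (\<Union>\<alpha> \<in> iso ?G ?G. {\<alpha> ?c, inv\<^bsub>?G\<^esub> (\<alpha> ?c)})"
    using ex_word_values_eq_automorphism_orbit[OF noncomm fin g gen cG] by blast
  have "(\<Union>\<alpha> \<in> iso ?G ?G. {\<alpha> ?c, inv\<^bsub>?G\<^esub> (\<alpha> ?c)}) = three_cycles n"
  proof (intro equalityI subsetI)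
    fix t assume "t \<in> (\<Union>\<alpha> \<in> iso ?G ?G. {\<alpha> ?c, inv\<^bsub>?G\<^esub> (\<alpha> ?c)})"
    then obtain \<alpha> where \<alpha>: "\<alpha> \<in> iso ?G ?G" and t: "t = \<alpha> ?c \<or> t = inv\<^bsub>?G\<^esub> (\<alpha> ?c)"
      by (elim UN_E insertE emptyE) blast+
    have \<alpha>c: "\<alpha> ?c \<in> three_cycles n"
      by (rule automorphism_three_cycle[OF n \<alpha> three_cycleI[OF c]])
    then obtain x y z where xyz: "\<alpha> ?c = cycle_of_list [x, y, z]" "distinct [x, y, z]" "{x, y, z} \<subseteq> {1..n}"
      by (rule three_cycleE)
    have "inv\<^bsub>?G\<^esub> (\<alpha> ?c) = cycle_of_list [z, y, x]"
      using alt_group_inv_equality[OF three_cycle_in_alt_group[OF xyz(2,3)]]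
        inv_three_cycle[OF xyz(2)] xyz(1) by (simp only:)
    moreover have "cycle_of_list [z, y, x] \<in> three_cycles n"
      using xyz(2,3) by (intro three_cycleI) auto
    ultimately show "t \<in> three_cycles n" using t \<alpha>c by (elim disjE) (simp_all only:)
  next
    fix t assume "t \<in> three_cycles n"
    then obtain x y z where t: "t = cycle_of_list [x, y, z]" "distinct [x, y, z]" "{x, y, z} \<subseteq> {1..n}"
      by (rule three_cycleE)
    have "n \<ge> 5" using n by simp
    from three_cycles_conjugate[OF this c t(2,3)]
    obtain p where p: "p \<in> carrier ?G" "p \<circ> ?c \<circ> inv' p = t" using t(1) by blast
    have "t = p \<otimes>\<^bsub>?G\<^esub> ?c \<otimes>\<^bsub>?G\<^esub> inv\<^bsub>?G\<^esub> p"
      using p by (simp add: alt_group_mult alt_group_inv_equality)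
    then show "t \<in> (\<Union>\<alpha> \<in> iso ?G ?G. {\<alpha> ?c, inv\<^bsub>?G\<^esub> (\<alpha> ?c)})"
      by (intro UN_I[OF conjugation_iso[OF p(1)]]) simp
  qed
  then show ?thesis using w by (simp only:) blast
qed

theorem theorem2:
  fixes n :: nat
  assumes "n \<ge> 7"
  shows "(n \<noteq> 13 \<longrightarrow> (\<exists>w \<in> carrier (free_group 2).
            word_values (alt_group n) 2 w = {\<one>\<^bsub>alt_group n\<^esub>} \<union> three_cycles n)) \<and>
         (n = 13 \<longrightarrow> (\<exists>w \<in> carrier (free_group 3).
            word_values (alt_group n) 3 w = {\<one>\<^bsub>alt_group n\<^esub>} \<union> three_cycles n))"
  by (intro conjI impI ex_word_with_values_three_cycles[OF assms]) simp_all

end
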